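(* Let $\{x^{(k)}\}$ be the sequence generated by the scaled inertial forward-backward method with backtracking described in the context. Assume that the scaling matrices $\{D_k\}\subset\mathcal{D}_\eta$ satisfy $$D_{k+1}\preceq(1+\eta_k)D_k\quad\forall k\ge 0,\qquad \eta_k\in\mathbb{R},\ \eta_k\ge 0,\ \sum_{k=0}^\infty\eta_k<\infty,$$ and that, for some real $a\ge 2$, $\theta_0=1$, $\beta_0=0$, and $\theta_k=\frac{a}{k+a}$, $\beta_k=\frac{k-1}{k+a}$ for $k\ge 1$. Let $x^*$ be a minimizer of $F$. Then there exists a constant $C$ such that $$F(x^{(k)})-F(x^* )\le\frac{C}{(k-1+a)^2}\qquad\text{for all }k\ge 1.$$
   Context: Problem: minimize $F(x)=f(x)+g(x)$ over $x\in\mathbb{R}^n$, where $f,g:\mathbb{R}^n\to\mathbb{R}\cup\{\infty\}$ are proper, convex and lower semicontinuous; $Y\subseteq\mathbb{R}^n$ is closed and convex with $\mathrm{dom}(f)\supseteq Y\supseteq\mathrm{dom}(g)$ ($\mathrm{dom}$ is the set where the function is finite); $f$ is differentiable with $L$-Lipschitz continuous gradient on $Y$ ($L>0$); $g$ is bounded from below over its domain; the problem has at least one solution. Notation: $\|\cdot\|$ is the Euclidean norm (and induced matrix norm); $\|x\|_D^2=x^TDx$ for symmetric positive definite $D$; $D_1\succeq D_2$ (equivalently $D_2\preceq D_1$) means $x^TD_1x\ge x^TD_2x$ for all $x$. For $\eta>0$, $\mathcal{D}_\eta$ is the set of symmetric positive definite $n\times n$ real matrices $D$ with $D\succeq\eta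 I$. $P_{Y,D}(x)=\arg\min_{y\in Y}\|y-x\|_D^2$. For $x\in Y$, $y\in\mathbb{R}^n$: $\ell(y;x)=f(x)+\nabla f(x)^T(y-x)$. For $\alpha>0$, $D\in\mathcal{D}_\eta$, $x\in Y$: $p_{\alpha,D}(x)$ is the unique minimizer over $y\in\mathbb{R}^n$ of $\ell(y;x)+g(y)+\frac{1}{2\alpha}\|x-y\|_D^2$. Algorithm: fix an initial trial steplength $\alpha_{-1}>0$, $\delta\in(0,1)$, $x^{(0)}\in Y$, $x^{(-1)}=x^{(0)}$, nonnegative numbers $\{\beta_k\}_{k\ge0}$ and matrices $\{D_k\}_{k\ge 0}\subset\mathcal{D}_\eta$ with $\sup_k\|D_k\|<\infty$. For $k=0,1,2,\dots$: set $y^{(k)}=P_{Y,D_k}(x^{(k)}+\beta_k(x^{(k)}-x^{(k-1)}))$; let $\alpha_k=\delta^{i_k}\alpha_{k-1}$, where $i_k$ is the smallest nonnegative integer such that $x_+^{(k)}=p_{\alpha_k,D_k}(y^{(k)})$ satisfies $f(x_+^{(k)})\le\ell(x_+^{(k)};y^{(k)})+\frac{1}{2\alpha_k}\|y^{(k)}-x_+^{(k)}\|_{D_k}^2$; set $x^{(k+1)}=x_+^{(k)}$. *)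

theory Defs
  imports "HOL-Analysis.Analysis"
begin

text \<open>Functions into the reals extended by \<open>\<infinity>\<close> are modelled as \<^typ>\<open>ereal\<close>-valued
  functions; properness excludes the value \<open>-\<infinity>\<close>.\<close>

definition edom :: "('a \<Rightarrow> ereal) \<Rightarrow> 'a set" where
  "edom f = {x. \<bar>f x\<bar> \<noteq> \<infinity>}"

definition proper :: "('a \<Rightarrow> ereal) \<Rightarrow> bool" where
  "proper f \<longleftrightarrow> (\<forall>x. f x \<noteq> -\<infinity>) \<and> (\<exists>x. f x \<noteq> \<infinity>)"

text \<open>In \<^typ>\<open>ereal\<close>, \<open>0 * \<infinity> = 0\<close>, so the end points \<open>t = 0\<close> and \<open>t = 1\<close> are harmless.\<close>

definition econvex :: "('a::real_vector \<Rightarrow> ereal) \<Rightarrow> bool" where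
  "econvex f \<longleftrightarrow> (\<forall>x y t. 0 \<le> t \<and> t \<le> 1 \<longrightarrow>
     f ((1 - t) *\<^sub>R x + t *\<^sub>R y) \<le> ereal (1 - t) * f x + ereal t * f y)"

definition lsc :: "('a::topological_space \<Rightarrow> ereal) \<Rightarrow> bool" where
  "lsc f \<longleftrightarrow> (\<forall>x. f x \<le> Liminf (at x) f)"

text \<open>Differentiability of an extended-valued function at \<open>x\<close> requires finiteness near \<open>x\<close>.
  The interior condition is needed because \<^const>\<open>real_of_ereal\<close> maps \<open>\<infinity>\<close> to \<open>0\<close>.\<close>

definition has_gradient :: "('a::real_inner \<Rightarrow> ereal) \<Rightarrow> 'a \<Rightarrow> 'a \<Rightarrow> bool" where
  "has_gradient f x v \<longleftrightarrow>
     x \<in> interior (edom f) \<and> GDERIV (\<lambda>z. real_of_ereal (f z)) x :> v"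

definition gradient :: "('a::real_inner \<Rightarrow> ereal) \<Rightarrow> 'a \<Rightarrow> 'a" where
  "gradient f x = (THE v. has_gradient f x v)"

definition minimizer :: "('a \<Rightarrow> ereal) \<Rightarrow> 'a \<Rightarrow> bool" where
  "minimizer F x \<longleftrightarrow> is_arg_min F (\<lambda>_. True) x"

definition composite_problem ::
  "(real^'n \<Rightarrow> ereal) \<Rightarrow> (real^'n \<Rightarrow> ereal) \<Rightarrow> (real^'n) set \<Rightarrow> real \<Rightarrow> bool" where
  "composite_problem f g Y L \<longleftrightarrow>
     proper f \<and> econvex f \<and> lsc f \<and>
     proper g \<and> econvex g \<and> lsc g \<and>
     closed Y \<and> convex Y \<and> Y \<subseteq> edom f \<and> edom g \<subseteq> Y \<and>
     (\<forall>x\<in>Y. \<exists>v. has_gradient f x v) \<and>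
     L > 0 \<and> L-lipschitz_on Y (gradient f) \<and>
     (\<exists>m::real. \<forall>x\<in>edom g. ereal m \<le> g x) \<and>
     (\<exists>x. minimizer (\<lambda>z. f z + g z) x)"

definition sqnorm :: "real^'n^'n \<Rightarrow> real^'n \<Rightarrow> real" where
  "sqnorm D x = x \<bullet> (D *v x)"

definition loewner_le :: "real^'n^'n \<Rightarrow> real^'n^'n \<Rightarrow> bool" (infix \<open>\<preceq>\<^sub>L\<close> 50) where
  "D1 \<preceq>\<^sub>L D2 \<longleftrightarrow> (\<forall>x. x \<bullet> (D1 *v x) \<le> x \<bullet> (D2 *v x))"

definition spd :: "real^'n^'n \<Rightarrow> bool" where
  "spd D \<longleftrightarrow> transpose D = D \<and> (\<forall>x. x \<noteq> 0 \<longrightarrow> 0 < x \<bullet> (D *v x))"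

definition scaling_set :: "real \<Rightarrow> (real^'n^'n) set" where
  "scaling_set \<eta> = {D. spd D \<and> \<eta> *\<^sub>R mat 1 \<preceq>\<^sub>L D}"

definition proj :: "(real^'n) set \<Rightarrow> real^'n^'n \<Rightarrow> real^'n \<Rightarrow> real^'n" where
  "proj Y D x = arg_min_on (\<lambda>y. sqnorm D (y - x)) Y"

definition linearization :: "('a::real_inner \<Rightarrow> ereal) \<Rightarrow> 'a \<Rightarrow> 'a \<Rightarrow> ereal" where
  "linearization f y x = f x + ereal (gradient f x \<bullet> (y - x))"

definition fb_step :: "(real^'n \<Rightarrow> ereal) \<Rightarrow> (real^'n \<Rightarrow> ereal) \<Rightarrow>
    real \<Rightarrow> real^'n^'n \<Rightarrow> real^'n \<Rightarrow> real^'n" where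
  "fb_step f g \<alpha> D x =
     arg_min_on (\<lambda>y. linearization f y x + g y + ereal (1 / (2 * \<alpha>) * sqnorm D (x - y))) UNIV"

definition step_accepted :: "(real^'n \<Rightarrow> ereal) \<Rightarrow> (real^'n \<Rightarrow> ereal) \<Rightarrow>
    real \<Rightarrow> real^'n^'n \<Rightarrow> real^'n \<Rightarrow> bool" where
  "step_accepted f g \<alpha> D y \<longleftrightarrow>
     (let xp = fb_step f g \<alpha> D y in
       f xp \<le> linearization f xp y + ereal (1 / (2 * \<alpha>) * sqnorm D (y - xp)))"

text \<open>The iterates \<open>x\<close> and steplengths \<open>\<alpha>\<close> generated from the initial trial steplength
  \<open>\<alpha>i\<close> (written \<open>\<alpha>\<close> with index \<open>-1\<close> on paper). Since subtraction on \<^typ>\<open>nat\<close> truncates,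
  \<^term>\<open>x (k - 1)\<close> at \<open>k = 0\<close> is \<^term>\<open>x 0\<close>, which is the convention
  that the iterate with index \<open>-1\<close> equals \<^term>\<open>x 0\<close>. The induced matrix norm
  is the operator norm \<^const>\<open>onorm\<close>.\<close>

definition generated_by_fb ::
  "(real^'n \<Rightarrow> ereal) \<Rightarrow> (real^'n \<Rightarrow> ereal) \<Rightarrow> (real^'n) set \<Rightarrow> real \<Rightarrow>
   real \<Rightarrow> real \<Rightarrow> (nat \<Rightarrow> real) \<Rightarrow> (nat \<Rightarrow> real^'n^'n) \<Rightarrow>
   (nat \<Rightarrow> real) \<Rightarrow> (nat \<Rightarrow> real^'n) \<Rightarrow> (nat \<Rightarrow> real^'n) \<Rightarrow> bool" where
  "generated_by_fb f g Y \<eta> \<alpha>i \<delta> \<beta> D \<alpha> y x \<longleftrightarrow>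
     \<alpha>i > 0 \<and> 0 < \<delta> \<and> \<delta> < 1 \<and> x 0 \<in> Y \<and> (\<forall>k. 0 \<le> \<beta> k) \<and>
     (\<forall>k. D k \<in> scaling_set \<eta>) \<and> bdd_above (range (\<lambda>k. onorm ((*v) (D k)))) \<and>
     (\<forall>k. y k = proj Y (D k) (x k + \<beta> k *\<^sub>R (x k - x (k - 1)))) \<and>
     (\<forall>k. let \<alpha>prev = (if k = 0 then \<alpha>i else \<alpha> (k - 1));
              i = (LEAST i. step_accepted f g (\<delta> ^ i * \<alpha>prev) (D k) (y k))
          in \<alpha> k = \<delta> ^ i * \<alpha>prev) \<and>
     (\<forall>k. x (Suc k) = fb_step f g (\<alpha> k) (D k) (y k))"

end

theory Submission
  imports Defs
begin

text \<open>
Let \<open>F = f + g\<close>. The proof finds an energy that grows by a summable relative amount per iteration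
and that contains the gap \<open>F (x\<^sub>k\<^sub>+\<^sub>1) - F x\<^sup>*\<close> with a weight of order \<open>k\<^sup>2\<close>.

An accepted forward-backward step from \<open>y\<close> to \<open>x\<^sub>+\<close> satisfies, for every \<open>u\<close> with \<open>g u\<close> finite,
\<open>F x\<^sub>+ + \<parallel>u - x\<^sub>+\<parallel>\<^sub>D\<^sup>2 / (2 \<alpha>) \<le> F u + \<parallel>u - y\<parallel>\<^sub>D\<^sup>2 / (2 \<alpha>)\<close> (\<open>fb_step_inequality\<close>). This combines
optimality of \<open>x\<^sub>+\<close> for the proximal model, the acceptance test, and convexity of \<open>f\<close>.

The parameters satisfy \<open>\<beta>\<^sub>k = \<theta>\<^sub>k (1 - \<theta>\<^sub>k\<^sub>-\<^sub>1) / \<theta>\<^sub>k\<^sub>-\<^sub>1\<close>. Hence, with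
\<open>z\<^sub>k = x\<^sub>k\<^sub>-\<^sub>1 + (x\<^sub>k - x\<^sub>k\<^sub>-\<^sub>1) / \<theta>\<^sub>k\<^sub>-\<^sub>1\<close>, the inertial point is \<open>(1 - \<theta>\<^sub>k) x\<^sub>k + \<theta>\<^sub>k z\<^sub>k\<close> and the next iterate
is \<open>(1 - \<theta>\<^sub>k) x\<^sub>k + \<theta>\<^sub>k z\<^sub>k\<^sub>+\<^sub>1\<close>. Taking \<open>u = (1 - \<theta>\<^sub>k) x\<^sub>k + \<theta>\<^sub>k x\<^sup>*\<close> turns both squared distances into
\<open>\<theta>\<^sub>k\<^sup>2\<close> times the squared distances of \<open>z\<^sub>k\<^sub>+\<^sub>1\<close> and \<open>z\<^sub>k\<close> to \<open>x\<^sup>*\<close>; the projection onto \<open>Y\<close> does no harm,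
being closer to \<open>u\<close> in the \<open>D\<^sub>k\<close>-norm than the inertial point (\<open>accelerated_step\<close>).

Consider \<open>E\<^sub>k = 2 \<alpha>\<^sub>k / \<theta>\<^sub>k\<^sup>2 (F (x\<^sub>k\<^sub>+\<^sub>1) - F x\<^sup>*) + \<parallel>z\<^sub>k\<^sub>+\<^sub>1 - x\<^sup>*\<parallel>\<^sup>2\<close>, the norm being that of \<open>D\<^sub>k\<close>. Steplengths
do not increase, \<open>(1 - \<theta>\<^sub>k\<^sub>+\<^sub>1) / \<theta>\<^sub>k\<^sub>+\<^sub>1\<^sup>2 \<le> 1 / \<theta>\<^sub>k\<^sup>2\<close>, and a change of metric costs a factor \<open>1 + e\<^sub>k\<close>, so
\<open>E\<^sub>k\<^sub>+\<^sub>1 \<le> (1 + e\<^sub>k) E\<^sub>k\<close> and the energies are bounded. Steplengths are also bounded away from zero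
(\<open>backtracking\<close>), so the gap is at most a multiple of \<open>\<theta>\<^sub>k\<^sup>2\<close>, which is \<open>a\<^sup>2 / (k + a)\<^sup>2\<close>.
\<close>

abbreviation real_val :: "('a \<Rightarrow> ereal) \<Rightarrow> 'a \<Rightarrow> real" where
  "real_val f x \<equiv> real_of_ereal (f x)"

section \<open>Extended-valued convex functions and gradients\<close>

lemma ereal_real_val: "x \<in> edom f \<Longrightarrow> f x = ereal (real_val f x)"
  by (simp add: edom_def ereal_real)

lemma edomI: "proper f \<Longrightarrow> f x < \<infinity> \<Longrightarrow> x \<in> edom f"
  by (auto simp: edom_def proper_def)

lemma convex_on_edom:
  assumes "proper f" "econvex f"
  shows "convex_on (edom f) (real_val f)"
proof (rule convex_onI)
  have fin: "(1 - t) *\<^sub>R x + t *\<^sub>R y \<in> edom f \<and>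
      real_val f ((1 - t) *\<^sub>R x + t *\<^sub>R y) \<le> (1 - t) * real_val f x + t * real_val f y"
    if "0 \<le> t" "t \<le> 1" "x \<in> edom f" "y \<in> edom f" for t x y
  proof -
    have "f ((1 - t) *\<^sub>R x + t *\<^sub>R y) \<le> ereal (1 - t) * f x + ereal t * f y"
      using assms(2) that by (auto simp: econvex_def)
    also have "\<dots> = ereal ((1 - t) * real_val f x + t * real_val f y)"
      using that(3,4) by (cases "f x"; cases "f y") (auto simp: edom_def)
    finally have le: "f ((1 - t) *\<^sub>R x + t *\<^sub>R y) \<le> \<dots>" .
    then have "(1 - t) *\<^sub>R x + t *\<^sub>R y \<in> edom f"
      by (intro edomI[OF assms(1)]) (auto simp: less_top[symmetric])
    then show ?thesis
      using le by (cases "f ((1 - t) *\<^sub>R x + t *\<^sub>R y)") (auto simp: edom_def)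
  qed
  show "real_val f ((1 - t) *\<^sub>R x + t *\<^sub>R y) \<le> (1 - t) * real_val f x + t * real_val f y"
    if "0 < t" "t < 1" "x \<in> edom f" "y \<in> edom f" for t x y
    using fin that by simp
  show "convex (edom f)"
    unfolding convex_alt using fin by simp
qed

lemma has_gradient_unique:
  assumes "has_gradient f x v" "has_gradient f x w"
  shows "v = w"
proof -
  have "(\<lambda>h. h \<bullet> v) = (\<lambda>h. h \<bullet> w)"
    using assms has_derivative_unique unfolding has_gradient_def gderiv_def by blast
  then have "(v - w) \<bullet> (v - w) = 0"
    by (metis inner_diff_right right_minus_eq)
  then show ?thesis by simp
qed

lemma gradient_eqI: "has_gradient f x v \<Longrightarrow> gradient f x = v"
  unfolding gradient_def using has_gradient_unique by blast

lemma has_gradient_along_segment: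
  assumes "has_gradient f (y + t *\<^sub>R d) v"
  shows "((\<lambda>s. real_val f (y + s *\<^sub>R d)) has_real_derivative d \<bullet> v) (at t)"
proof -
  have "(real_val f has_derivative (\<lambda>h. h \<bullet> v)) (at (y + t *\<^sub>R d))"
    using assms by (simp add: has_gradient_def gderiv_def)
  moreover have "((\<lambda>s. y + s *\<^sub>R d) has_derivative (\<lambda>h. h *\<^sub>R d)) (at t)"
    by (auto intro!: derivative_eq_intros)
  ultimately have "((\<lambda>s. real_val f (y + s *\<^sub>R d)) has_derivative (\<lambda>h. (h *\<^sub>R d) \<bullet> v)) (at t)"
    using has_derivative_compose by blast
  then show ?thesis
    by (simp add: has_field_derivative_def mult.commute[of _ "d \<bullet> v"] mult_commute_abs)
qed

lemma gradient_inequality: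
  assumes "convex_on (edom f) (real_val f)" "has_gradient f y v" "y \<in> edom f" "x \<in> edom f"
  shows "real_val f y + v \<bullet> (x - y) \<le> real_val f x"
proof -
  define \<phi> where "\<phi> t = real_val f (y + t *\<^sub>R (x - y))" for t
  have "(\<phi> has_real_derivative (x - y) \<bullet> v) (at 0)"
    unfolding \<phi>_def using has_gradient_along_segment[of f y 0 "x - y" v] assms(2) by simp
  then have "((\<lambda>t. (\<phi> t - \<phi> 0) / t) \<longlongrightarrow> (x - y) \<bullet> v) (at 0)"
    by (simp add: has_field_derivative_iff)
  then have lim: "((\<lambda>t. (\<phi> t - \<phi> 0) / t) \<longlongrightarrow> (x - y) \<bullet> v) (at_right 0)"
    by (rule filterlim_at_split[THEN iffD1, THEN conjunct2])
  have "(\<phi> t - \<phi> 0) / t \<le> real_val f x - real_val f y" if "0 < t" "t < 1" for t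
  proof -
    have "y + t *\<^sub>R (x - y) = (1 - t) *\<^sub>R y + t *\<^sub>R x"
      by (simp add: algebra_simps)
    then have "\<phi> t \<le> (1 - t) * real_val f y + t * real_val f x"
      using convex_onD[OF assms(1), of t y x] that assms(3,4) by (simp add: \<phi>_def)
    then have "\<phi> t - \<phi> 0 \<le> t * (real_val f x - real_val f y)"
      by (simp add: \<phi>_def algebra_simps)
    then show ?thesis using that by (simp add: divide_le_eq mult.commute)
  qed
  then have "\<forall>\<^sub>F t in at_right 0. (\<phi> t - \<phi> 0) / t \<le> real_val f x - real_val f y"
    unfolding eventually_at_right_field by (intro exI[of _ 1]) auto
  then have "(x - y) \<bullet> v \<le> real_val f x - real_val f y"
    using tendsto_upperbound[OF lim] by simp
  then show ?thesis by (simp add: inner_commute)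
qed

text \<open>Along the segment from \<open>y\<close> to \<open>x\<close> the derivative of \<open>f\<close> exceeds its value at \<open>y\<close> by at
  most \<open>t L \<parallel>x - y\<parallel>\<^sup>2\<close>, so subtracting the quadratic model leaves a nonincreasing function of \<open>t\<close>.
  Only points of \<open>Y\<close> are visited, which is why a gradient that is Lipschitz on \<open>Y\<close> suffices.\<close>

lemma descent_lemma:
  assumes "convex Y" "\<forall>z\<in>Y. \<exists>v. has_gradient f z v" "L-lipschitz_on Y (gradient f)"
    and "y \<in> Y" "x \<in> Y"
  shows "real_val f x \<le> real_val f y + gradient f y \<bullet> (x - y) + L / 2 * (norm (x - y))\<^sup>2"
proof -
  define d where "d = x - y"
  define r where "r t = real_val f (y + t *\<^sub>R d) - t * (d \<bullet> gradient f y)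
      - L / 2 * t\<^sup>2 * (norm d)\<^sup>2" for t
  have "r 1 \<le> r 0"
  proof (rule DERIV_nonpos_imp_nonincreasing[of 0 1], simp)
    fix t :: real assume t: "0 \<le> t" "t \<le> 1"
    let ?z = "y + t *\<^sub>R d"
    have "?z = (1 - t) *\<^sub>R y + t *\<^sub>R x" by (simp add: d_def algebra_simps)
    then have z: "?z \<in> Y" using assms(1,4,5) t by (simp add: convex_alt)
    then have "has_gradient f ?z (gradient f ?z)"
      using assms(2) gradient_eqI by metis
    then have "(r has_real_derivative d \<bullet> gradient f ?z - d \<bullet> gradient f y - L * t * (norm d)\<^sup>2) (at t)"
      unfolding r_def
      by (auto intro!: derivative_eq_intros has_gradient_along_segment)
    moreover have "d \<bullet> gradient f ?z - d \<bullet> gradient f y \<le> L * t * (norm d)\<^sup>2"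
    proof -
      have "d \<bullet> gradient f ?z - d \<bullet> gradient f y \<le> norm d * norm (gradient f ?z - gradient f y)"
        by (metis inner_diff_right norm_cauchy_schwarz)
      also have "\<dots> \<le> norm d * (L * norm (?z - y))"
        using lipschitz_onD[OF assms(3) z assms(4)]
        by (intro mult_left_mono) (simp_all add: dist_norm)
      also have "\<dots> = L * t * (norm d)\<^sup>2"
        using t by (simp add: power2_eq_square)
      finally show ?thesis .
    qed
    ultimately show "\<exists>D. (r has_real_derivative D) (at t) \<and> D \<le> 0"
      by (metis diff_le_0_iff_le)
  qed
  then show ?thesis
    by (simp add: r_def d_def inner_commute)
qed

section \<open>Quadratic forms of positive definite matrices\<close>

lemma spd_inner_commute:
  assumes "spd D"
  shows "u \<bullet> (D *v w) = w \<bullet> (D *v u)"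
proof -
  have "u \<bullet> (D *v w) = (transpose D *v u) \<bullet> w"
    by (simp only: transpose_matrix_vector dot_lmul_matrix)
  also have "transpose D = D" using assms by (simp add: spd_def)
  finally show ?thesis by (simp only: inner_commute)
qed

lemma sqnorm_add_scaleR:
  assumes "spd D"
  shows "sqnorm D (u + t *\<^sub>R d) = sqnorm D u + 2 * t * (u \<bullet> (D *v d)) + t\<^sup>2 * sqnorm D d"
  using spd_inner_commute[OF assms, of d u]
  by (simp add: sqnorm_def matrix_vector_right_distrib matrix_vector_mult_scaleR inner_add_left
      inner_add_right algebra_simps power2_eq_square)

lemma sqnorm_scaleR: "sqnorm D (t *\<^sub>R d) = t\<^sup>2 * sqnorm D d"
  by (simp add: sqnorm_def matrix_vector_mult_scaleR power2_eq_square)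

lemma sqnorm_minus_commute: "sqnorm D (u - w) = sqnorm D (w - u)"
  using sqnorm_scaleR[of D "-1" "w - u"] by simp

lemma sqnorm_nonneg: "spd D \<Longrightarrow> 0 \<le> sqnorm D u"
  by (cases "u = 0") (auto simp: spd_def sqnorm_def less_imp_le)

lemma scaling_set_spd: "D \<in> scaling_set \<eta> \<Longrightarrow> spd D"
  by (simp add: scaling_set_def)

lemma scaling_set_sqnorm_ge: "D \<in> scaling_set \<eta> \<Longrightarrow> \<eta> * (norm u)\<^sup>2 \<le> sqnorm D u"
  by (auto simp: scaling_set_def loewner_le_def sqnorm_def scaleR_matrix_vector_assoc[symmetric]
      power2_norm_eq_inner)

lemma continuous_on_sqnorm: "continuous_on S (\<lambda>u. sqnorm D (u - p))"
  unfolding sqnorm_def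
  by (intro continuous_intros bounded_linear.continuous_on[OF matrix_vector_mul_bounded_linear])

lemma bounded_sublevel_affine_plus_sqnorm:
  assumes "0 < \<eta>" "D \<in> scaling_set \<eta>" "0 < \<kappa>"
  shows "bounded {u. b + v \<bullet> (u - p) + \<kappa> * sqnorm D (u - p) \<le> c}"
proof (rule boundedI)
  fix u assume "u \<in> {u. b + v \<bullet> (u - p) + \<kappa> * sqnorm D (u - p) \<le> c}"
  then have le: "b + v \<bullet> (u - p) + \<kappa> * sqnorm D (u - p) \<le> c" by simp
  define s where "s = norm (u - p)"
  define K where "K = \<kappa> * \<eta>"
  define M where "M = norm v + \<bar>c - b\<bar>"
  have K: "0 < K" using assms by (simp add: K_def)
  have "K * s\<^sup>2 \<le> \<kappa> * sqnorm D (u - p)"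
    using scaling_set_sqnorm_ge[OF assms(2), of "u - p"] assms(3)
    by (simp add: K_def s_def mult.assoc)
  moreover have "- (norm v * s) \<le> v \<bullet> (u - p)"
    using Cauchy_Schwarz_ineq2[of v "u - p"] by (simp add: s_def abs_le_iff)
  ultimately have q: "K * s\<^sup>2 \<le> norm v * s + \<bar>c - b\<bar>" using le by linarith
  have "s \<le> 1 + M / K"
  proof (cases "s \<le> 1")
    case True
    then show ?thesis using K by (simp add: M_def add_increasing2)
  next
    case False
    then have "\<bar>c - b\<bar> \<le> \<bar>c - b\<bar> * s" by (simp add: mult_le_cancel_left1)
    then have "(K * s) * s \<le> M * s"
      using q by (simp add: M_def power2_eq_square algebra_simps)
    then have "K * s \<le> M" using False by (simp add: mult_le_cancel_right)
    then have "s \<le> M / K" using K by (simp add: le_divide_eq mult.commute)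
    then show ?thesis by simp
  qed
  then show "norm u \<le> 1 + M / K + norm p"
    using norm_triangle_sub[of u p] by (simp add: s_def)
qed

section \<open>Existence of minimizers\<close>

text \<open>If every point of the compact sublevel set had a strictly better competitor \<open>w\<close>, the open
  sets of points worse than some \<open>w\<close> would cover it; the best \<open>w\<close> of a finite subcover lies in the
  sublevel set and is covered by no set of the subcover.\<close>

lemma lower_semicontinuous_attains_min:
  fixes h :: "'a::heine_borel \<Rightarrow> ereal"
  assumes low: "\<And>x c. c < h x \<Longrightarrow> \<forall>\<^sub>F u in nhds x. c < h u"
    and bd: "bounded {u. h u \<le> h u0}"
  shows "\<exists>w. \<forall>u. h w \<le> h u"
proof (rule ccontr)
  assume "\<not> ?thesis"
  then have better: "\<exists>w. h w < h u" for u by (auto simp: not_le)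
  have op: "open {u. c < h u}" for c
  proof (subst open_subopen, intro ballI)
    fix x assume "x \<in> {u. c < h u}"
    then obtain T where "open T" "x \<in> T" "\<forall>u\<in>T. c < h u"
      using low[of c x] unfolding eventually_nhds by blast
    then show "\<exists>T. open T \<and> x \<in> T \<and> T \<subseteq> {u. c < h u}"
      by (intro exI[of _ T]) auto
  qed
  let ?K = "{u. h u \<le> h u0}"
  have "?K = - {u. h u0 < h u}" by auto
  then have "closed ?K" by (simp only: closed_Compl op)
  then have "compact ?K" using bd compact_eq_bounded_closed by blast
  moreover have "?K \<subseteq> (\<Union>w\<in>?K. {u. h w < h u})"
  proof
    fix u assume "u \<in> ?K"
    moreover obtain w where "h w < h u" using better by blast
    ultimately have "w \<in> ?K" by simp
    with \<open>h w < h u\<close> show "u \<in> (\<Union>w\<in>?K. {u. h w < h u})" by blast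
  qed
  ultimately obtain C where C: "C \<subseteq> ?K" "finite C" "?K \<subseteq> (\<Union>w\<in>C. {u. h w < h u})"
    using compactE_image[of ?K ?K "\<lambda>w. {u. h w < h u}"] op by metis
  have "u0 \<in> ?K" by simp
  then have "C \<noteq> {}" using C(3) by blast
  then obtain w where w: "w \<in> C" "\<forall>v\<in>C. h w \<le> h v"
    using arg_min_if_finite[OF C(2), of h] by (meson not_le)
  then obtain v where "v \<in> C" "h v < h w" using C(1,3) by blast
  then show False using w(2) by (simp add: not_le[symmetric])
qed

lemma lsc_plus_continuous_attains_min:
  fixes g :: "'a::heine_borel \<Rightarrow> ereal"
  assumes "lsc g" and below: "\<And>u. ereal m \<le> g u" and "g u0 \<noteq> \<infinity>"
    and cont: "continuous_on UNIV r" and bd: "\<And>c. bounded {u. r u \<le> c}"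
  shows "\<exists>w. \<forall>u. g w + ereal (r w) \<le> g u + ereal (r u)"
proof (rule lower_semicontinuous_attains_min[where ?u0.0 = u0])
  fix x c assume c: "c < g x + ereal (r x)"
  then obtain s where s: "c < ereal s" "ereal s < g x + ereal (r x)"
    using ereal_dense2 by blast
  have "ereal (s - r x) < g x" using s(2) by (cases "g x") auto
  also have "\<dots> \<le> Liminf (at x) g" using assms(1) by (simp add: lsc_def)
  finally have g: "\<forall>\<^sub>F u in at x. ereal (s - r x) < g u" by (rule less_LiminfD)
  have "((\<lambda>u. ereal (s - r x + r u)) \<longlongrightarrow> ereal (s - r x + r x)) (at x)"
    using cont by (intro tendsto_intros) (simp add: continuous_on_def)
  then have "\<forall>\<^sub>F u in at x. c < ereal (s - r x + r u)"
    by (rule order_tendstoD(1)) (simp add: s(1))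
  with g have "\<forall>\<^sub>F u in at x. c < g u + ereal (r u)"
  proof eventually_elim
    case (elim u)
    from elim(1) have "ereal (s - r x + r u) \<le> g u + ereal (r u)" by (cases "g u") auto
    with elim(2) show ?case by (rule less_le_trans)
  qed
  then show "\<forall>\<^sub>F u in nhds x. c < g u + ereal (r u)"
    using c by (simp add: eventually_nhds_conv_at)
next
  define c where "c = real_of_ereal (g u0) + r u0"
  have "g u0 \<noteq> -\<infinity>" using below[of u0] by auto
  then have c: "g u0 + ereal (r u0) = ereal c"
    using assms(3) by (cases "g u0") (auto simp: c_def)
  have "r u \<le> c - m" if "g u + ereal (r u) \<le> ereal c" for u
    using that below[of u] by (cases "g u") auto
  then show "bounded {u. g u + ereal (r u) \<le> g u0 + ereal (r u0)}"
    unfolding c by (intro bounded_subset[OF bd[of "c - m"]]) auto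
qed

lemma arg_min_on_minimizes:
  fixes \<phi> :: "'a \<Rightarrow> 'b::linorder"
  assumes "w \<in> S" "\<And>u. u \<in> S \<Longrightarrow> \<phi> w \<le> \<phi> u"
  shows "arg_min_on \<phi> S \<in> S" "\<And>u. u \<in> S \<Longrightarrow> \<phi> (arg_min_on \<phi> S) \<le> \<phi> u"
proof -
  have "is_arg_min \<phi> (\<lambda>u. u \<in> S) w"
    using assms by (auto simp: is_arg_min_linorder)
  then have "is_arg_min \<phi> (\<lambda>u. u \<in> S) (arg_min_on \<phi> S)"
    unfolding arg_min_on_def arg_min_def by (rule someI)
  then show "arg_min_on \<phi> S \<in> S" "\<And>u. u \<in> S \<Longrightarrow> \<phi> (arg_min_on \<phi> S) \<le> \<phi> u"
    by (auto simp: is_arg_min_linorder)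
qed

section \<open>The scaled proximal inequality and the projection\<close>

text \<open>Comparing the minimizer \<open>w\<close> with \<open>w + t (u - w)\<close> bounds an affine function of \<open>t\<close> from
  below by zero; its value at \<open>t = 0\<close> is the first-order optimality condition, and expanding the
  square around \<open>w\<close> gives the extra term \<open>c \<parallel>u - w\<parallel>\<^sub>D\<^sup>2\<close>. Both the proximal step and the projection,
  which has \<open>\<psi> = 0\<close>, are instances.\<close>

lemma prox_inequality:
  assumes "spd D" "convex_on S \<psi>" "w \<in> S" "u \<in> S"
    and min: "\<And>u. u \<in> S \<Longrightarrow> \<psi> w + c * sqnorm D (w - p) \<le> \<psi> u + c * sqnorm D (u - p)"
  shows "\<psi> w + c * sqnorm D (w - p) + c * sqnorm D (u - w) \<le> \<psi> u + c * sqnorm D (u - p)"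
proof -
  define d where "d = u - w"
  define b where "b = (w - p) \<bullet> (D *v d)"
  define A where "A = \<psi> u - \<psi> w + 2 * c * b"
  define B where "B = c * sqnorm D d"
  have AB: "0 \<le> A + t * B" if t: "0 < t" "t < 1" for t
  proof -
    have comb: "w + t *\<^sub>R d = (1 - t) *\<^sub>R w + t *\<^sub>R u" by (simp add: d_def algebra_simps)
    then have "w + t *\<^sub>R d \<in> S"
      using convex_on_imp_convex[OF assms(2)] assms(3,4) t by (simp add: convex_alt)
    moreover have "\<psi> (w + t *\<^sub>R d) \<le> (1 - t) * \<psi> w + t * \<psi> u"
      using convex_onD[OF assms(2), of t w u] comb t assms(3,4) by simp
    moreover have "sqnorm D (w + t *\<^sub>R d - p) = sqnorm D (w - p) + 2 * t * b + t\<^sup>2 * sqnorm D d"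
      using sqnorm_add_scaleR[OF assms(1), of "w - p" t d] by (simp add: b_def algebra_simps)
    ultimately have "\<psi> w + c * sqnorm D (w - p) \<le> (1 - t) * \<psi> w + t * \<psi> u
        + c * (sqnorm D (w - p) + 2 * t * b + t\<^sup>2 * sqnorm D d)"
      using min[of "w + t *\<^sub>R d"] by simp
    then have "0 \<le> t * (A + t * B)"
      by (simp add: A_def B_def algebra_simps power2_eq_square)
    then show ?thesis using t by (simp add: zero_le_mult_iff)
  qed
  have "((\<lambda>t. A + t * B) \<longlongrightarrow> A + 0 * B) (at_right 0)"
    by (intro tendsto_intros)
  moreover have "\<forall>\<^sub>F t in at_right 0. 0 \<le> A + t * B"
    unfolding eventually_at_right_field using AB by (intro exI[of _ 1]) auto
  ultimately have "0 \<le> A"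
    using tendsto_lowerbound by fastforce
  moreover have "sqnorm D (u - p) = sqnorm D (w - p) + 2 * b + sqnorm D d"
    using sqnorm_add_scaleR[OF assms(1), of "w - p" 1 d] by (simp add: b_def d_def)
  ultimately show ?thesis
    by (simp add: A_def d_def algebra_simps)
qed

lemma
  assumes "closed Y" "convex Y" "u \<in> Y" "0 < \<eta>" "D \<in> scaling_set \<eta>"
  shows proj_in: "proj Y D p \<in> Y"
    and sqnorm_proj_le: "sqnorm D (u - proj Y D p) \<le> sqnorm D (u - p)"
proof -
  let ?K = "Y \<inter> {v. sqnorm D (v - p) \<le> sqnorm D (u - p)}"
  have "bounded {v. sqnorm D (v - p) \<le> sqnorm D (u - p)}"
    using bounded_sublevel_affine_plus_sqnorm[OF assms(4,5), of 1 0 0 p] by simp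
  moreover have "closed {v. sqnorm D (v - p) \<le> sqnorm D (u - p)}"
    by (intro closed_Collect_le continuous_on_sqnorm continuous_on_const)
  ultimately have "compact ?K"
    using assms(1) by (auto simp: compact_eq_bounded_closed intro: bounded_subset)
  moreover have "u \<in> ?K" using assms(3) by simp
  ultimately obtain w where w: "w \<in> ?K" "\<forall>v\<in>?K. sqnorm D (w - p) \<le> sqnorm D (v - p)"
    using continuous_attains_inf[OF _ _ continuous_on_sqnorm, of ?K D p] by blast
  then have "sqnorm D (w - p) \<le> sqnorm D (v - p)" if "v \<in> Y" for v
    using that by (cases "v \<in> ?K") auto
  then have min: "proj Y D p \<in> Y"
      "\<And>v. v \<in> Y \<Longrightarrow> sqnorm D (proj Y D p - p) \<le> sqnorm D (v - p)"
    unfolding proj_def using arg_min_on_minimizes[of w Y "\<lambda>v. sqnorm D (v - p)"] w(1) by auto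
  show "proj Y D p \<in> Y" by (rule min(1))
  have "sqnorm D (proj Y D p - p) + sqnorm D (u - proj Y D p) \<le> sqnorm D (u - p)"
    using prox_inequality[OF scaling_set_spd[OF assms(5)], of Y "\<lambda>_. 0" "proj Y D p" u 1 p]
      assms(2,3) min by (simp add: convex_on_const)
  then show "sqnorm D (u - proj Y D p) \<le> sqnorm D (u - p)"
    using sqnorm_nonneg[OF scaling_set_spd[OF assms(5)], of "proj Y D p - p"] by linarith
qed

section \<open>One forward-backward step\<close>

lemma composite_problem_bounded_below:
  assumes "composite_problem f g Y L"
  obtains m where "\<And>u. ereal m \<le> g u"
proof -
  obtain m :: real where m: "\<forall>u\<in>edom g. ereal m \<le> g u"
    using assms by (auto simp: composite_problem_def)
  have "proper g" using assms by (simp add: composite_problem_def)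
  then have "ereal m \<le> g u" for u
    using m edomI[of g u] by (cases "g u = \<infinity>") (auto simp: less_top[symmetric])
  then show ?thesis by (rule that)
qed

text \<open>The objective of the step is \<open>g\<close> plus a continuous strongly convex quadratic \<open>r\<close>. As \<open>g\<close> is bounded
  below, sublevel sets of the objective lie in those of \<open>r\<close>, which are bounded, so a minimizer
  exists and \<^const>\<open>arg_min_on\<close> selects one.\<close>

lemma
  assumes cp: "composite_problem f g Y L" and "0 < \<eta>" "D \<in> scaling_set \<eta>" "0 < \<alpha>" "y \<in> Y"
  shows fb_step_in_edom: "fb_step f g \<alpha> D y \<in> edom g"
    and fb_step_minimizes: "u \<in> edom g \<Longrightarrow>
      (real_val f y + gradient f y \<bullet> (fb_step f g \<alpha> D y - y) + real_val g (fb_step f g \<alpha> D y))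
        + 1 / (2 * \<alpha>) * sqnorm D (fb_step f g \<alpha> D y - y)
      \<le> (real_val f y + gradient f y \<bullet> (u - y) + real_val g u) + 1 / (2 * \<alpha>) * sqnorm D (u - y)"
proof -
  define r where "r u = real_val f y + gradient f y \<bullet> (u - y) + 1 / (2 * \<alpha>) * sqnorm D (u - y)" for u
  define h where "h u = linearization f u y + g u + ereal (1 / (2 * \<alpha>) * sqnorm D (y - u))" for u
  have prp: "proper g" and "lsc g" and y: "y \<in> edom f"
    using cp assms(5) by (auto simp: composite_problem_def)
  obtain m where m: "\<And>u. ereal m \<le> g u"
    using composite_problem_bounded_below[OF cp] by blast
  have fy: "f y = ereal (real_val f y)" by (rule ereal_real_val[OF y])
  have h: "h u = g u + ereal (r u)" for u
    unfolding h_def linearization_def r_def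
    by (subst fy, subst sqnorm_minus_commute, cases "g u") auto
  obtain u0 where u0: "g u0 \<noteq> \<infinity>" using prp by (auto simp: proper_def)
  have "continuous_on UNIV r"
    unfolding r_def by (intro continuous_intros continuous_on_sqnorm)
  moreover have "bounded {u. r u \<le> c}" for c
    unfolding r_def using assms(2-4) by (intro bounded_sublevel_affine_plus_sqnorm) auto
  ultimately obtain w where "\<forall>u. h w \<le> h u"
    unfolding h using lsc_plus_continuous_attains_min[OF \<open>lsc g\<close> m u0] by blast
  then have min: "h (fb_step f g \<alpha> D y) \<le> h u" for u
    using arg_min_on_minimizes(2)[of w UNIV h u] by (simp add: fb_step_def h_def[abs_def])
  have "h (fb_step f g \<alpha> D y) \<le> g u0 + ereal (r u0)" using min[of u0] by (simp add: h)
  also have "\<dots> < \<infinity>" using u0 by (cases "g u0") auto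
  finally have "g (fb_step f g \<alpha> D y) < \<infinity>" unfolding h
    by (cases "g (fb_step f g \<alpha> D y)") auto
  then show dom: "fb_step f g \<alpha> D y \<in> edom g" by (rule edomI[OF prp])
  show "(real_val f y + gradient f y \<bullet> (fb_step f g \<alpha> D y - y) + real_val g (fb_step f g \<alpha> D y))
        + 1 / (2 * \<alpha>) * sqnorm D (fb_step f g \<alpha> D y - y)
      \<le> (real_val f y + gradient f y \<bullet> (u - y) + real_val g u) + 1 / (2 * \<alpha>) * sqnorm D (u - y)"
    if u: "u \<in> edom g"
  proof -
    have "ereal (real_val g (fb_step f g \<alpha> D y)) + ereal (r (fb_step f g \<alpha> D y))
        \<le> ereal (real_val g u) + ereal (r u)"
      using min[of u] unfolding h by (metis ereal_real_val u dom)
    then show ?thesis by (simp add: r_def)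
  qed
qed

text \<open>The accepted step majorizes \<open>f\<close> at the new point, and the linearization at \<open>y\<close> minorizes
  \<open>f\<close> on its domain; the proximal inequality for the linearized model therefore passes to \<open>F = f + g\<close>
  itself, with no trace of the gradient left.\<close>

lemma fb_step_inequality:
  assumes cp: "composite_problem f g Y L" and "0 < \<eta>" "D \<in> scaling_set \<eta>" "0 < \<alpha>" "y \<in> Y"
    and acc: "step_accepted f g \<alpha> D y" and u: "u \<in> edom g"
  defines "xp \<equiv> fb_step f g \<alpha> D y"
  shows "real_val f xp + real_val g xp + 1 / (2 * \<alpha>) * sqnorm D (u - xp)
    \<le> real_val f u + real_val g u + 1 / (2 * \<alpha>) * sqnorm D (u - y)"
proof -
  define \<psi> where "\<psi> v = real_val f y + gradient f y \<bullet> (v - y) + real_val g v" for v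
  have xp: "xp \<in> edom g"
    unfolding xp_def by (rule fb_step_in_edom[OF assms(1-5)])
  have Y: "edom g \<subseteq> edom f" "y \<in> edom f"
    and cf: "convex_on (edom f) (real_val f)" and cg: "convex_on (edom g) (real_val g)"
    and grad: "has_gradient f y (gradient f y)"
    using cp assms(5) convex_on_edom gradient_eqI unfolding composite_problem_def by blast+
  have "convex_on (edom g) (\<lambda>v. real_val f y + gradient f y \<bullet> (v - y))"
    using convex_on_imp_convex[OF cg]
    by (intro convex_onI) (auto simp: algebra_simps inner_add_right inner_diff_right)
  then have "convex_on (edom g) \<psi>"
    unfolding \<psi>_def using cg by (rule convex_on_add)
  then have prox: "\<psi> xp + 1 / (2 * \<alpha>) * sqnorm D (xp - y) + 1 / (2 * \<alpha>) * sqnorm D (u - xp)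
      \<le> \<psi> u + 1 / (2 * \<alpha>) * sqnorm D (u - y)"
    using fb_step_minimizes[OF assms(1-5)] u xp unfolding \<psi>_def xp_def
    by (intro prox_inequality[OF scaling_set_spd[OF assms(3)]]) auto
  have "f xp \<le> f y + ereal (gradient f y \<bullet> (xp - y)) + ereal (1 / (2 * \<alpha>) * sqnorm D (y - xp))"
    using acc by (simp add: step_accepted_def Let_def linearization_def xp_def)
  then have "real_val f xp \<le> real_val f y + gradient f y \<bullet> (xp - y)
      + 1 / (2 * \<alpha>) * sqnorm D (xp - y)"
    using subsetD[OF Y(1) xp] Y(2) sqnorm_minus_commute[of D y xp]
    by (cases "f xp"; cases "f y") (auto simp: edom_def)
  moreover have "real_val f y + gradient f y \<bullet> (u - y) \<le> real_val f u"
    using gradient_inequality[OF cf grad] Y u by blast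
  ultimately show ?thesis using prox by (simp add: \<psi>_def)
qed

lemma step_accepted_if_small:
  assumes cp: "composite_problem f g Y L" and "0 < \<eta>" "D \<in> scaling_set \<eta>" "0 < \<alpha>" "y \<in> Y"
    and small: "\<alpha> \<le> \<eta> / L"
  shows "step_accepted f g \<alpha> D y"
proof -
  define xp where "xp = fb_step f g \<alpha> D y"
  have "xp \<in> edom g" unfolding xp_def by (rule fb_step_in_edom[OF assms(1-5)])
  then have xp: "xp \<in> Y" and L: "0 < L" and Y: "Y \<subseteq> edom f"
    using cp by (auto simp: composite_problem_def)
  have "L / 2 \<le> 1 / (2 * \<alpha>) * \<eta>"
    using small L assms(4) by (simp add: field_simps)
  then have "L / 2 * (norm (xp - y))\<^sup>2 \<le> 1 / (2 * \<alpha>) * \<eta> * (norm (xp - y))\<^sup>2"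
    by (rule mult_right_mono) simp
  also have "\<dots> = 1 / (2 * \<alpha>) * (\<eta> * (norm (xp - y))\<^sup>2)" by simp
  also have "\<dots> \<le> 1 / (2 * \<alpha>) * sqnorm D (xp - y)"
    using assms(4) by (intro mult_left_mono scaling_set_sqnorm_ge[OF assms(3)]) simp
  finally have "real_val f xp \<le> real_val f y + gradient f y \<bullet> (xp - y)
      + 1 / (2 * \<alpha>) * sqnorm D (xp - y)"
    using descent_lemma[of Y f L y xp] cp xp assms(5) by (simp add: composite_problem_def)
  then have "f xp \<le> f y + ereal (gradient f y \<bullet> (xp - y)) + ereal (1 / (2 * \<alpha>) * sqnorm D (y - xp))"
    using Y xp assms(5) sqnorm_minus_commute[of D y xp]
    by (cases "f xp"; cases "f y") (auto simp: edom_def subset_iff)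
  then show ?thesis
    by (simp add: step_accepted_def Let_def linearization_def xp_def)
qed

text \<open>Backtracking stops because steps below \<open>\<eta> / L\<close> are accepted. If the trial
  step was reduced at all, the last rejected step exceeded \<open>\<eta> / L\<close>, and the accepted one is \<open>\<delta>\<close> times
  that.\<close>

lemma backtracking:
  assumes cp: "composite_problem f g Y L" and "0 < \<eta>" "D \<in> scaling_set \<eta>" "0 < \<alpha>" "y \<in> Y"
    and \<delta>: "0 < \<delta>" "\<delta> < 1"
  defines "\<alpha>' \<equiv> \<delta> ^ (LEAST i. step_accepted f g (\<delta> ^ i * \<alpha>) D y) * \<alpha>"
  shows "0 < \<alpha>'" "\<alpha>' \<le> \<alpha>" "step_accepted f g \<alpha>' D y" "min \<alpha> (\<delta> * \<eta> / L) \<le> \<alpha>'"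
proof -
  define i where "i = (LEAST i. step_accepted f g (\<delta> ^ i * \<alpha>) D y)"
  have \<alpha>': "\<alpha>' = \<delta> ^ i * \<alpha>" by (simp add: \<alpha>'_def i_def)
  have L: "0 < L" using cp by (simp add: composite_problem_def)
  have acc: "step_accepted f g (\<delta> ^ j * \<alpha>) D y" if "\<delta> ^ j * \<alpha> \<le> \<eta> / L" for j
    using step_accepted_if_small[OF assms(1-3) _ assms(5) that] \<delta>(1) assms(4) by simp
  obtain j where "\<delta> ^ j < \<eta> / L / \<alpha>"
    using real_arch_pow_inv[of "\<eta> / L / \<alpha>" \<delta>] \<delta> L assms(2,4) by auto
  then have "\<delta> ^ j * \<alpha> \<le> \<eta> / L"
    unfolding pos_less_divide_eq[OF assms(4)] by (rule less_imp_le)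
  then show "step_accepted f g \<alpha>' D y"
    unfolding \<alpha>'_def by (rule LeastI[OF acc])
  show "0 < \<alpha>'" using \<alpha>' \<delta> assms(4) by simp
  show "\<alpha>' \<le> \<alpha>"
    using \<alpha>' \<delta> assms(4) by (simp add: mult_le_cancel_right1 power_le_one)
  show "min \<alpha> (\<delta> * \<eta> / L) \<le> \<alpha>'"
  proof (cases i)
    case 0
    then show ?thesis by (simp add: \<alpha>')
  next
    case (Suc j)
    then have "\<not> step_accepted f g (\<delta> ^ j * \<alpha>) D y"
      using not_less_Least[of j "\<lambda>i. step_accepted f g (\<delta> ^ i * \<alpha>) D y"] by (simp add: i_def)
    then have "\<eta> / L < \<delta> ^ j * \<alpha>" using acc[of j] by linarith
    then have "\<delta> * (\<eta> / L) \<le> \<delta> * (\<delta> ^ j * \<alpha>)"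
      using \<delta>(1) by (intro mult_left_mono) auto
    then show ?thesis by (simp add: \<alpha>' Suc)
  qed
qed

section \<open>Acceleration\<close>

text \<open>The comparison point \<open>u = (1 - \<theta>) x + \<theta> x\<^sup>*\<close> is chosen so that the differences to the
  extrapolated point and to the new iterate are \<open>\<theta>\<close> times the distances of \<open>z\<close> and \<open>z'\<close> to \<open>x\<^sup>*\<close>.
  Replacing the extrapolated point by its projection only shortens the distance to \<open>u \<in> Y\<close>.
  The alternative \<open>\<theta> = 1\<close> covers the first iteration: the starting point lies in \<open>Y\<close>, but \<open>g\<close> may be
  infinite there.\<close>

lemma accelerated_step:
  assumes cp: "composite_problem f g Y L" and "0 < \<eta>" "D \<in> scaling_set \<eta>" "0 < \<alpha>"
    and \<theta>: "0 < \<theta>" "\<theta> \<le> 1" and x: "x \<in> edom g \<or> \<theta> = 1" and xs: "xs \<in> edom g"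
    and y: "y = proj Y D ((1 - \<theta>) *\<^sub>R x + \<theta> *\<^sub>R z)"
    and acc: "step_accepted f g \<alpha> D y"
    and xp: "fb_step f g \<alpha> D y = (1 - \<theta>) *\<^sub>R x + \<theta> *\<^sub>R z'"
  defines "F \<equiv> \<lambda>u. real_val f u + real_val g u"
  shows "2 * \<alpha> / \<theta>\<^sup>2 * (F (fb_step f g \<alpha> D y) - F xs) + sqnorm D (z' - xs)
    \<le> 2 * \<alpha> * ((1 - \<theta>) / \<theta>\<^sup>2) * (F x - F xs) + sqnorm D (z - xs)"
proof -
  define u where "u = (1 - \<theta>) *\<^sub>R x + \<theta> *\<^sub>R xs"
  define c where "c = 2 * \<alpha> / \<theta>\<^sup>2"
  have sub: "edom g \<subseteq> Y" "Y \<subseteq> edom f" and Y: "closed Y" "convex Y"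
    and cf: "convex_on (edom f) (real_val f)" and cg: "convex_on (edom g) (real_val g)"
    using cp convex_on_edom unfolding composite_problem_def by blast+
  have u: "u \<in> edom g" and Fu: "F u \<le> (1 - \<theta>) * F x + \<theta> * F xs"
  proof -
    have "u \<in> edom g \<and> F u \<le> (1 - \<theta>) * F x + \<theta> * F xs"
    proof (cases "\<theta> = 1")
      case True
      then show ?thesis using xs by (simp add: u_def)
    next
      case False
      then have x: "x \<in> edom g" using x by simp
      have "real_val f u \<le> (1 - \<theta>) * real_val f x + \<theta> * real_val f xs"
        unfolding u_def using \<theta> x xs sub by (intro convex_onD[OF cf]) auto
      moreover have "real_val g u \<le> (1 - \<theta>) * real_val g x + \<theta> * real_val g xs"
        unfolding u_def using \<theta> x xs by (intro convex_onD[OF cg]) auto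
      moreover have "u \<in> edom g"
        using convex_on_imp_convex[OF cg] x xs \<theta> by (simp add: u_def convex_alt)
      ultimately show ?thesis by (simp add: F_def algebra_simps)
    qed
    then show "u \<in> edom g" "F u \<le> (1 - \<theta>) * F x + \<theta> * F xs" by auto
  qed
  have uY: "u \<in> Y" using u sub by blast
  have yY: "y \<in> Y" unfolding y by (rule proj_in[OF Y uY assms(2,3)])
  have "u - fb_step f g \<alpha> D y = \<theta> *\<^sub>R (xs - z')"
    by (simp add: xp u_def algebra_simps)
  then have new: "sqnorm D (u - fb_step f g \<alpha> D y) = \<theta>\<^sup>2 * sqnorm D (z' - xs)"
    by (simp add: sqnorm_scaleR sqnorm_minus_commute[of D xs])
  have "u - ((1 - \<theta>) *\<^sub>R x + \<theta> *\<^sub>R z) = \<theta> *\<^sub>R (xs - z)"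
    by (simp add: u_def algebra_simps)
  then have "sqnorm D (u - ((1 - \<theta>) *\<^sub>R x + \<theta> *\<^sub>R z)) = \<theta>\<^sup>2 * sqnorm D (z - xs)"
    by (simp add: sqnorm_scaleR sqnorm_minus_commute[of D xs])
  then have old: "sqnorm D (u - y) \<le> \<theta>\<^sup>2 * sqnorm D (z - xs)"
    unfolding y using sqnorm_proj_le[OF Y uY assms(2,3)] by metis
  have "F (fb_step f g \<alpha> D y) + 1 / (2 * \<alpha>) * (\<theta>\<^sup>2 * sqnorm D (z' - xs))
      \<le> F u + 1 / (2 * \<alpha>) * sqnorm D (u - y)"
    using fb_step_inequality[OF assms(1-4) yY acc u] by (simp only: new F_def)
  also have "\<dots> \<le> (1 - \<theta>) * F x + \<theta> * F xs + 1 / (2 * \<alpha>) * (\<theta>\<^sup>2 * sqnorm D (z - xs))"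
    using Fu old assms(4) by (intro add_mono mult_left_mono) auto
  finally have "F (fb_step f g \<alpha> D y) - F xs + 1 / (2 * \<alpha>) * (\<theta>\<^sup>2 * sqnorm D (z' - xs))
      \<le> (1 - \<theta>) * (F x - F xs) + 1 / (2 * \<alpha>) * (\<theta>\<^sup>2 * sqnorm D (z - xs))"
    by (simp add: algebra_simps)
  then have "c * (F (fb_step f g \<alpha> D y) - F xs + 1 / (2 * \<alpha>) * (\<theta>\<^sup>2 * sqnorm D (z' - xs)))
      \<le> c * ((1 - \<theta>) * (F x - F xs) + 1 / (2 * \<alpha>) * (\<theta>\<^sup>2 * sqnorm D (z - xs)))"
    using assms(4) \<theta> by (intro mult_left_mono) (simp_all add: c_def)
  moreover have "c * (1 / (2 * \<alpha>) * (\<theta>\<^sup>2 * s)) = s" for s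
    using assms(4) \<theta> by (simp add: c_def)
  ultimately show ?thesis
    by (simp add: distrib_left c_def)
qed

text \<open>The factors \<open>1 + e\<^sub>k \<le> exp e\<^sub>k\<close> multiply to at most \<open>exp (\<Sum>k. e\<^sub>k)\<close>.\<close>

lemma bounded_of_summable_growth:
  fixes E e :: "nat \<Rightarrow> real"
  assumes "\<And>k. E (Suc k) \<le> (1 + e k) * E k" "\<And>k. 0 \<le> e k" "summable e" "0 \<le> E 0"
  shows "E k \<le> E 0 * exp (suminf e)"
proof -
  have "E k \<le> E 0 * exp (\<Sum>i<k. e i)"
  proof (induction k)
    case 0
    show ?case by simp
  next
    case (Suc k)
    have "E (Suc k) \<le> (1 + e k) * (E 0 * exp (\<Sum>i<k. e i))"
      using assms(1)[of k] mult_left_mono[OF Suc.IH, of "1 + e k"] assms(2)[of k] by linarith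
    also have "\<dots> \<le> exp (e k) * (E 0 * exp (\<Sum>i<k. e i))"
      using assms(4) by (intro mult_right_mono) auto
    finally show ?case by (simp add: exp_add mult_ac)
  qed
  also have "\<dots> \<le> E 0 * exp (suminf e)"
    using sum_le_suminf[OF assms(3), of "{..<k}"] assms(2,4) by (intro mult_left_mono) auto
  finally show ?thesis .
qed

text \<open>This is \<open>(1 - \<theta>\<^sub>k\<^sub>+\<^sub>1) / \<theta>\<^sub>k\<^sub>+\<^sub>1\<^sup>2 \<le> 1 / \<theta>\<^sub>k\<^sup>2\<close> for \<open>\<theta>\<^sub>k = a / (k + a)\<close>; cleared of denominators it reads
  \<open>(k + 1) (k + 1 + a) \<le> (k + a)\<^sup>2\<close>, and this is where \<open>a \<ge> 2\<close> enters.\<close>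

lemma inertial_weights_decrease:
  fixes a :: real
  assumes "2 \<le> a" "0 \<le> k"
  shows "(1 - a / (k + 1 + a)) / (a / (k + 1 + a))\<^sup>2 \<le> 1 / (a / (k + a))\<^sup>2"
proof -
  have pos: "0 < k + 1 + a" "0 < a" "0 < k + a" using assms by auto
  have "0 \<le> (a - 2) * k" "0 \<le> (a - 2) * (a + 1)" using assms by auto
  then have "(k + 1) * (k + 1 + a) \<le> (k + a)\<^sup>2"
    by (simp add: algebra_simps power2_eq_square)
  then have "(k + 1) * (k + 1 + a) / a\<^sup>2 \<le> (k + a)\<^sup>2 / a\<^sup>2"
    by (rule divide_right_mono) simp
  moreover have "1 - a / (k + 1 + a) = (k + 1) / (k + 1 + a)"
    using pos by (simp add: field_simps)
  ultimately show ?thesis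
    using pos by (simp add: power_divide power2_eq_square)
qed

theorem theorem3p1:
  fixes f g :: "real^'n \<Rightarrow> ereal"
    and Y :: "(real^'n) set"
    and L \<eta> \<alpha>i \<delta> a :: real
    and \<alpha> \<beta> \<theta> e :: "nat \<Rightarrow> real"
    and D :: "nat \<Rightarrow> real^'n^'n"
    and x y :: "nat \<Rightarrow> real^'n"
    and xstar :: "real^'n"
  assumes "composite_problem f g Y L"
    and "\<eta> > 0"
    and "generated_by_fb f g Y \<eta> \<alpha>i \<delta> \<beta> D \<alpha> y x"
    and "\<forall>k. D (Suc k) \<preceq>\<^sub>L (1 + e k) *\<^sub>R D k"
    and "\<forall>k. 0 \<le> e k"
    and "summable e"
    and "a \<ge> 2"
    and "\<theta> 0 = 1" and "\<beta> 0 = 0"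
    and "\<forall>k\<ge>1. \<theta> k = a / (real k + a)"
    and "\<forall>k\<ge>1. \<beta> k = (real k - 1) / (real k + a)"
    and "minimizer (\<lambda>z. f z + g z) xstar"
  shows "\<exists>C::real. \<forall>k\<ge>1.
    (f (x k) + g (x k)) - (f xstar + g xstar) \<le> ereal (C / (real k - 1 + a)\<^sup>2)"
proof -
  note cp = assms(1) and \<eta> = assms(2)
  have gen: "0 < \<alpha>i" "0 < \<delta>" "\<delta> < 1" "x 0 \<in> Y" "\<And>k. D k \<in> scaling_set \<eta>"
    and y: "\<And>k. y k = proj Y (D k) (x k + \<beta> k *\<^sub>R (x k - x (k - 1)))"
    and \<alpha>: "\<And>k. \<alpha> k = \<delta> ^ (LEAST i. step_accepted f g
          (\<delta> ^ i * (if k = 0 then \<alpha>i else \<alpha> (k - 1))) (D k) (y k))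
        * (if k = 0 then \<alpha>i else \<alpha> (k - 1))"
    and x: "\<And>k. x (Suc k) = fb_step f g (\<alpha> k) (D k) (y k)"
    using assms(3) unfolding generated_by_fb_def Let_def by blast+
  have prp: "proper f" "proper g" and sub: "edom g \<subseteq> Y" "Y \<subseteq> edom f"
    and Y: "closed Y" "convex Y" and L: "0 < L"
    using cp by (auto simp: composite_problem_def)
  have yY: "y k \<in> Y" for k
    unfolding y by (rule proj_in[OF Y gen(4) \<eta> gen(5)])

  define \<alpha>min where "\<alpha>min = min \<alpha>i (\<delta> * \<eta> / L)"
  have \<alpha>min: "0 < \<alpha>min" using gen \<eta> L by (simp add: \<alpha>min_def)
  have step: "0 < \<alpha> k \<and> \<alpha> k \<le> \<alpha>p \<and> step_accepted f g (\<alpha> k) (D k) (y k) \<and> \<alpha>min \<le> \<alpha> k"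
    if "\<alpha>p = (if k = 0 then \<alpha>i else \<alpha> (k - 1))" "0 < \<alpha>p" "\<alpha>min \<le> \<alpha>p" for k \<alpha>p
  proof -
    have "\<alpha>min \<le> min \<alpha>p (\<delta> * \<eta> / L)" using that(3) by (simp add: \<alpha>min_def)
    then show ?thesis
      using backtracking[OF cp \<eta> gen(5)[of k] that(2) yY[of k] gen(2,3)]
      unfolding \<alpha>[of k] that(1)[symmetric] by linarith
  qed
  have ge: "\<alpha>min \<le> \<alpha> k" for k
  proof (induction k)
    case 0
    show ?case using step[of \<alpha>i 0] gen(1) by (simp add: \<alpha>min_def)
  next
    case (Suc k)
    then show ?case using step[of "\<alpha> k" "Suc k"] \<alpha>min by simp
  qed
  have acc: "step_accepted f g (\<alpha> k) (D k) (y k)" for k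
    using step[of "if k = 0 then \<alpha>i else \<alpha> (k - 1)" k] gen(1) \<alpha>min ge[of "k - 1"]
    by (cases k) (auto simp: \<alpha>min_def)
  have \<alpha>pos: "0 < \<alpha> k" for k using ge[of k] \<alpha>min by simp
  have dec: "\<alpha> (Suc k) \<le> \<alpha> k" for k
    using step[of "\<alpha> k" "Suc k"] \<alpha>pos ge by simp

  \<comment> \<open>The value \<open>\<theta> 0 = 1\<close> also follows this formula, so the step from 0 to 1 needs no separate case.\<close>
  have \<theta>: "\<theta> k = a / (real k + a)" for k
    using assms(7,8,10) by (cases k) auto
  have \<theta>01: "0 < \<theta> k" "\<theta> k \<le> 1" for k
    using assms(7) by (auto simp: \<theta> divide_le_eq)
  have xdom: "x (Suc k) \<in> edom g" for k
    unfolding x by (rule fb_step_in_edom[OF cp \<eta> gen(5) \<alpha>pos yY])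

  define F where "F u = real_val f u + real_val g u" for u
  have Fe: "f u + g u = ereal (F u)" if "u \<in> edom g" for u
  proof -
    have "u \<in> edom f" using that sub by blast
    then show ?thesis
      unfolding F_def plus_ereal.simps(1)[symmetric] using that by (metis ereal_real_val)
  qed
  have min: "f xstar + g xstar \<le> f u + g u" for u
    using assms(12) by (auto simp: minimizer_def is_arg_min_linorder)
  have xs: "xstar \<in> edom g"
  proof (rule edomI[OF prp(2)])
    have "f xstar + g xstar < \<infinity>" using min[of "x 1"] Fe[of "x 1"] xdom[of 0] by (auto simp: less_top[symmetric])
    moreover have "f xstar \<noteq> -\<infinity>" using prp by (simp add: proper_def)
    ultimately show "g xstar < \<infinity>" by (cases "f xstar"; cases "g xstar") auto
  qed
  have F_ge: "F xstar \<le> F (x (Suc k))" for k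
    using min[of "x (Suc k)"] Fe[OF xs] Fe[OF xdom] by simp

  \<comment> \<open>At \<open>k = 0\<close> the truncated subtraction makes this \<open>z 0 = x 0\<close>.\<close>
  define z where "z k = x (k - 1) + (1 / \<theta> (k - 1)) *\<^sub>R (x k - x (k - 1))" for k
  have extrapolation: "x k + \<beta> k *\<^sub>R (x k - x (k - 1)) = (1 - \<theta> k) *\<^sub>R x k + \<theta> k *\<^sub>R z k" for k
  proof (cases k)
    case 0
    then show ?thesis using assms(8,9) by (simp add: z_def)
  next
    case (Suc j)
    define \<rho> where "\<rho> = 1 / \<theta> j - 1"
    have "\<beta> k = real j / (real k + a)" using assms(11) Suc by simp
    also have "\<dots> = \<theta> k * \<rho>"
      using assms(7) by (simp add: \<rho>_def \<theta> field_simps Suc)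
    finally have \<beta>: "\<beta> k = \<theta> k * \<rho>" .
    have z: "z k = x k + \<rho> *\<^sub>R (x k - x j)"
      by (simp add: z_def \<rho>_def Suc algebra_simps)
    have "x k + (\<theta> k * \<rho>) *\<^sub>R (x k - x j)
        = (1 - \<theta> k) *\<^sub>R x k + \<theta> k *\<^sub>R (x k + \<rho> *\<^sub>R (x k - x j))"
      by (simp add: algebra_simps)
    then show ?thesis by (simp add: \<beta> z) (simp add: Suc)
  qed
  have xz: "fb_step f g (\<alpha> k) (D k) (y k) = (1 - \<theta> k) *\<^sub>R x k + \<theta> k *\<^sub>R z (Suc k)" for k
    using \<theta>01(1)[of k] by (simp add: x[symmetric] z_def algebra_simps)

  define E where "E k = 2 * \<alpha> k / (\<theta> k)\<^sup>2 * (F (x (Suc k)) - F xstar)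
      + sqnorm (D k) (z (Suc k) - xstar)" for k
  have E_step: "E (Suc k) \<le> (1 + e k) * E k" for k
  proof -
    let ?v = "F (x (Suc k)) - F xstar" and ?s = "sqnorm (D k) (z (Suc k) - xstar)"
    let ?w = "1 / (\<theta> k)\<^sup>2"
    have v: "0 \<le> ?v" using F_ge by simp
    have "E (Suc k) \<le> 2 * \<alpha> (Suc k) * ((1 - \<theta> (Suc k)) / (\<theta> (Suc k))\<^sup>2) * ?v
        + sqnorm (D (Suc k)) (z (Suc k) - xstar)"
      unfolding E_def x[of "Suc k"] F_def
      by (rule accelerated_step[OF cp \<eta> gen(5) \<alpha>pos \<theta>01 _ xs _ acc xz])
        (simp_all add: xdom y extrapolation[symmetric])
    also have "\<dots> \<le> 2 * \<alpha> k * ?w * ?v + (1 + e k) * ?s"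
    proof (intro add_mono mult_right_mono[OF _ v])
      have "(1 - \<theta> (Suc k)) / (\<theta> (Suc k))\<^sup>2 \<le> ?w"
        using inertial_weights_decrease[OF assms(7), of "real k"] by (simp add: \<theta> add_ac)
      then show "2 * \<alpha> (Suc k) * ((1 - \<theta> (Suc k)) / (\<theta> (Suc k))\<^sup>2) \<le> 2 * \<alpha> k * ?w"
        using dec[of k] \<alpha>pos[of k] \<alpha>pos[of "Suc k"] \<theta>01[of "Suc k"]
        by (intro mult_mono) auto
      show "sqnorm (D (Suc k)) (z (Suc k) - xstar) \<le> (1 + e k) * ?s"
        using assms(4) by (simp add: loewner_le_def sqnorm_def scaleR_matrix_vector_assoc[symmetric])
    qed
    also have "\<dots> \<le> (1 + e k) * (2 * \<alpha> k * ?w * ?v) + (1 + e k) * ?s"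
    proof (intro add_right_mono)
      have "0 \<le> 2 * \<alpha> k * ?w * ?v" using \<alpha>pos[of k] v by simp
      from mult_nonneg_nonneg[OF assms(5)[rule_format, of k] this]
      show "2 * \<alpha> k * ?w * ?v \<le> (1 + e k) * (2 * \<alpha> k * ?w * ?v)"
        unfolding distrib_right by linarith
    qed
    also have "\<dots> = (1 + e k) * E k" by (simp add: E_def distrib_left)
    finally show ?thesis .
  qed
  have s_nonneg: "0 \<le> sqnorm (D k) u" for k u
    by (rule sqnorm_nonneg[OF scaling_set_spd[OF gen(5)]])
  have "0 \<le> E 0" using \<alpha>pos[of 0] F_ge[of 0] s_nonneg by (simp add: E_def)
  then have bound: "E k \<le> E 0 * exp (suminf e)" for k
    using bounded_of_summable_growth[OF E_step _ assms(6)] assms(5) by blast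

  \<comment> \<open>Dropping the distance term of the energy and using \<open>\<alpha> k \<ge> \<alpha>min\<close> leaves the gap times
      \<open>2 * \<alpha>min / (\<theta> k)\<^sup>2\<close>; solving for the gap gives this constant.\<close>
  define C where "C = E 0 * exp (suminf e) * a\<^sup>2 / (2 * \<alpha>min)"
  have rate: "F (x (Suc k)) - F xstar \<le> C / (real k + a)\<^sup>2" for k
  proof -
    have pos: "0 < real k + a" using assms(7) by simp
    have "2 * \<alpha>min / (\<theta> k)\<^sup>2 * (F (x (Suc k)) - F xstar) \<le> 2 * \<alpha> k / (\<theta> k)\<^sup>2 * (F (x (Suc k)) - F xstar)"
      using ge[of k] F_ge[of k] by (intro mult_right_mono divide_right_mono) auto
    also have "\<dots> \<le> E 0 * exp (suminf e)"
      using bound[of k] s_nonneg[of k "z (Suc k) - xstar"] by (simp add: E_def)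
    finally have "F (x (Suc k)) - F xstar \<le> E 0 * exp (suminf e) * (\<theta> k)\<^sup>2 / (2 * \<alpha>min)"
      using \<alpha>min \<theta>01(1)[of k] by (simp add: field_simps)
    also have "\<dots> = C / (real k + a)\<^sup>2"
      by (simp add: C_def \<theta> power_divide)
    finally show ?thesis .
  qed
  show ?thesis
  proof (intro exI[of _ C] allI impI)
    fix k :: nat assume "1 \<le> k"
    then obtain j where k: "k = Suc j" by (cases k) auto
    show "(f (x k) + g (x k)) - (f xstar + g xstar) \<le> ereal (C / (real k - 1 + a)\<^sup>2)"
      using rate[of j] by (simp add: k Fe[OF xs] Fe[OF xdom])
  qed
qed

end
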